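(* Let $d\ge1$ and let $\mu$ be a Borel measure on $\mathbb S^d$ with $\mu(\mathbb S^d)=1$. Then $$\int_{\mathbb S^d}\Big(\mu(H(x))-\frac12\Big)^2d\sigma(x)=\frac12\Big(\frac12-I(\mu)\Big).$$
   Context: $\mathbb S^d\subset\mathbb R^{d+1}$ is the unit sphere, $\sigma$ is the normalized surface measure ($\sigma(\mathbb S^d)=1$), and $d(x,y)=\frac1\pi\arccos(x\cdot y)$ is the normalized geodesic distance. $H(x)=\{z\in\mathbb S^d:z\cdot x>0\}$ is the open hemisphere centered at $x$. The geodesic distance energy integral is $I(\mu)=\int_{\mathbb S^d}\int_{\mathbb S^d}d(x,y)\,d\mu(x)\,d\mu(y)$. *)

theory Defs
  imports "HOL-Analysis.Analysis"
begin

definition radial_cone :: "'a::real_vector set \<Rightarrow> 'a set" where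
  "radial_cone A = {r *\<^sub>R x | r x. 0 < r \<and> r \<le> 1 \<and> x \<in> A}"

text \<open>Surface measure on the unit sphere, as in the polar coordinates formula
  \<open>\<integral> f = \<integral>\<^sub>0\<^sup>\<infinity> \<integral> f (r x) r\<^sup>n\<^sup>-\<^sup>1 dS(x) dr\<close>: the measure of \<open>A\<close> is \<open>n\<close> times the
  volume of the solid cone over \<open>A\<close> with apex at the origin, where \<open>n\<close> is the dimension of
  the ambient space. The formula is confirmed below by \<open>emeasure_sphere_surface_measure\<close>.\<close>

definition sphere_surface_measure :: "'a::euclidean_space measure" where
  "sphere_surface_measure =
    measure_of (sphere 0 1) (sets (restrict_space borel (sphere 0 1)))
      (\<lambda>A. of_nat DIM('a) * emeasure lborel (radial_cone A))"

definition normalized_surface_measure :: "'a::euclidean_space measure" where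
  "normalized_surface_measure =
    scale_measure (1 / emeasure (sphere_surface_measure :: 'a measure) (sphere 0 1))
      sphere_surface_measure"

definition normalized_geodesic_dist :: "'a::real_inner \<Rightarrow> 'a \<Rightarrow> real" where
  "normalized_geodesic_dist x y = arccos (x \<bullet> y) / pi"

definition open_hemisphere :: "'a::real_inner \<Rightarrow> 'a set" where
  "open_hemisphere x = {z \<in> sphere 0 1. z \<bullet> x > 0}"

definition geodesic_energy :: "'a::real_inner measure \<Rightarrow> real" where
  "geodesic_energy \<mu> = (\<integral>y. (\<integral>x. normalized_geodesic_dist x y \<partial>\<mu>) \<partial>\<mu>)"

lemma radial_cone_eq_vimage:
  fixes A :: "'a::euclidean_space set"
  assumes "A \<subseteq> sphere 0 1"
  shows "radial_cone A = (\<lambda>y. y /\<^sub>R norm y) -` A \<inter> (cball 0 1 - {0})"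
proof (intro set_eqI iffI)
  fix y assume "y \<in> radial_cone A"
  then show "y \<in> (\<lambda>y. y /\<^sub>R norm y) -` A \<inter> (cball 0 1 - {0})"
    using assms by (fastforce simp: radial_cone_def)
next
  fix y assume "y \<in> (\<lambda>y. y /\<^sub>R norm y) -` A \<inter> (cball 0 1 - {0})"
  then have "y = norm y *\<^sub>R (y /\<^sub>R norm y) \<and> 0 < norm y \<and> norm y \<le> 1 \<and> y /\<^sub>R norm y \<in> A"
    by auto
  then show "y \<in> radial_cone A"
    unfolding radial_cone_def by blast
qed

lemma borel_radial_cone:
  fixes A :: "'a::euclidean_space set"
  assumes "A \<in> sets (restrict_space borel (sphere 0 1))"
  shows "radial_cone A \<in> sets borel"
proof -
  have A: "A \<in> sets borel" "A \<subseteq> sphere 0 1"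
    using assms by (auto simp: sets_restrict_space_iff)
  have f: "(\<lambda>y::'a. y /\<^sub>R norm y) \<in> borel \<rightarrow>\<^sub>M borel"
    by measurable
  have "(\<lambda>y. y /\<^sub>R norm y) -` A \<in> sets borel"
    using measurable_sets[OF f A(1)] by (simp only: space_borel Int_UNIV_right)
  then show ?thesis
    by (simp add: radial_cone_eq_vimage[OF A(2)] sets.Int sets.Diff)
qed

lemma space_sphere_surface_measure [simp]:
  "space (sphere_surface_measure :: 'a::euclidean_space measure) = sphere 0 1"
  and sets_sphere_surface_measure [simp, measurable_cong]:
  "sets (sphere_surface_measure :: 'a::euclidean_space measure) =
    sets (restrict_space borel (sphere 0 1))"
proof -
  have sub: "sets (restrict_space borel (sphere 0 1)) \<subseteq> Pow (sphere (0::'a) 1)"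
    using sets.space_closed[of "restrict_space borel (sphere (0::'a) 1)"]
    by (simp add: space_restrict_space)
  then show "space (sphere_surface_measure :: 'a measure) = sphere 0 1"
    by (simp add: sphere_surface_measure_def space_measure_of)
  show "sets (sphere_surface_measure :: 'a measure) = sets (restrict_space borel (sphere 0 1))"
    using sub sets.sigma_sets_eq[of "restrict_space borel (sphere (0::'a) 1)"]
    by (simp add: sphere_surface_measure_def sets_measure_of space_restrict_space)
qed

lemma emeasure_sphere_surface_measure:
  fixes A :: "'a::euclidean_space set"
  assumes A: "A \<in> sets (restrict_space borel (sphere 0 1))"
  shows "emeasure sphere_surface_measure A = of_nat DIM('a) * emeasure lborel (radial_cone A)"
proof (rule emeasure_measure_of[OF sphere_surface_measure_def])
  let ?S = "restrict_space borel (sphere (0::'a) 1)"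
  show "sets ?S \<subseteq> Pow (sphere 0 1)"
    using sets.space_closed[of ?S] by (simp add: space_restrict_space)
  show "A \<in> sets sphere_surface_measure"
    using A by simp
  show "positive (sets sphere_surface_measure)
      (\<lambda>A. of_nat DIM('a) * emeasure lborel (radial_cone A :: 'a set))"
    by (simp add: positive_def radial_cone_def)
  show "countably_additive (sets sphere_surface_measure)
      (\<lambda>A. of_nat DIM('a) * emeasure lborel (radial_cone A :: 'a set))"
  proof (rule countably_additiveI)
    fix B :: "nat \<Rightarrow> 'a set"
    assume B: "range B \<subseteq> sets sphere_surface_measure" "disjoint_family B"
    then have sub: "B i \<subseteq> sphere 0 1" and meas: "radial_cone (B i) \<in> sets lborel" for i
      using borel_radial_cone[of "B i"] by (auto simp: sets_restrict_space)
    have un: "(\<Union>i. radial_cone (B i)) = radial_cone (\<Union>i. B i)"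
      by (auto simp: radial_cone_def)
    have "disjoint_family (\<lambda>i. radial_cone (B i))"
      using B(2) by (fastforce simp: disjoint_family_on_def radial_cone_eq_vimage[OF sub])
    with meas have "(\<Sum>i. emeasure lborel (radial_cone (B i))) =
        emeasure lborel (\<Union>i. radial_cone (B i))"
      by (intro suminf_emeasure) auto
    then show "(\<Sum>i. of_nat DIM('a) * emeasure lborel (radial_cone (B i))) =
        of_nat DIM('a) * emeasure lborel (radial_cone (\<Union>i. B i))"
      by (simp add: un)
  qed
qed

lemma emeasure_sphere_surface_measure_sphere:
  "emeasure (sphere_surface_measure :: 'a::euclidean_space measure) (sphere 0 1) =
    ennreal (DIM('a) * unit_ball_vol DIM('a))"
proof -
  have S: "sphere (0::'a) 1 \<in> sets (restrict_space borel (sphere 0 1))"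
    by (simp add: sets_restrict_space_iff)
  have "radial_cone (sphere (0::'a) 1) = cball 0 1 - {0}"
    by (auto simp: radial_cone_eq_vimage)
  moreover have "emeasure lborel (cball 0 1 - {0::'a}) = emeasure lborel (cball (0::'a) 1)"
    by (subst emeasure_Diff) auto
  ultimately show ?thesis
    by (simp add: emeasure_sphere_surface_measure[OF S] emeasure_cball ennreal_mult
        ennreal_of_nat_eq_real_of_nat)
qed

lemma space_normalized_surface_measure [simp]:
  "space (normalized_surface_measure :: 'a::euclidean_space measure) = sphere 0 1"
  and sets_normalized_surface_measure [simp, measurable_cong]:
  "sets (normalized_surface_measure :: 'a::euclidean_space measure) =
    sets (restrict_space borel (sphere 0 1))"
  by (simp_all add: normalized_surface_measure_def space_scale_measure)

lemma emeasure_normalized_surface_measure_sphere: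
  "emeasure (normalized_surface_measure :: 'a::euclidean_space measure) (sphere 0 1) = 1"
proof -
  define c where "c = DIM('a) * unit_ball_vol DIM('a)"
  have "c > 0"
    by (simp add: c_def)
  then have "1 / ennreal c * ennreal c = 1"
    by (simp add: ennreal_divide_times ennreal_divide_self)
  then show ?thesis
    by (simp only: normalized_surface_measure_def emeasure_scale_measure
        emeasure_sphere_surface_measure_sphere c_def)
qed

end

theory Submission
  imports Defs "HOL-Probability.Probability_Measure"
begin

text \<open>Writing \<open>\<mu>(H(x))\<close> as the \<open>\<mu>\<close>-integral of \<open>1\<^bsub>x \<bullet> y > 0\<^esub>\<close>, expanding the square and
  exchanging integrals reduces the identity to \<open>\<sigma>(H(y) \<inter> H(z)) = (1 - d(y, z)) / 2\<close>. The hemisphere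
  \<open>H(y)\<close> is the disjoint union of \<open>H(y) \<inter> H(z)\<close> and the lune of points in \<open>H(y)\<close>
  but not in \<open>H(z)\<close>. Since Lebesgue measure is rotation invariant, the volume of the cone over the
  lune depends only on the angle between \<open>y\<close> and \<open>z\<close> and is additive in it, so, being nonnegative,
  it is linear in the angle.\<close>

section \<open>Additive functions on an interval\<close>

text \<open>Nonnegativity makes an additive function monotone, which replaces continuity: on a grid
  of width \<open>c / N\<close> it is linear, and between grid points it varies by at most
  \<open>g c / N\<close>, which tends to 0.\<close>

lemma additive_nonneg_imp_linear_on_interval:
  fixes g :: "real \<Rightarrow> real"
  assumes "c > 0" "0 \<le> t" "t \<le> c"
    and add: "\<And>s t. 0 \<le> s \<Longrightarrow> 0 \<le> t \<Longrightarrow> s + t \<le> c \<Longrightarrow> g (s + t) = g s + g t"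
    and nonneg: "\<And>t. 0 \<le> t \<Longrightarrow> t \<le> c \<Longrightarrow> 0 \<le> g t"
  shows "g t = t / c * g c"
proof -
  have g0: "g 0 = 0"
    using add[of 0 0] \<open>c > 0\<close> by simp
  have mult: "g (real k * s) = real k * g s" if "0 \<le> s" "real k * s \<le> c" for k s
    using that(2)
  proof (induction k)
    case (Suc k)
    then have "real k * s \<le> c" "real k * s + s \<le> c"
      using \<open>0 \<le> s\<close> by (auto simp: algebra_simps)
    then show ?case
      using add[of "real k * s" s] Suc.IH \<open>0 \<le> s\<close> by (simp add: algebra_simps)
  qed (simp add: g0)
  have close: "\<bar>g t - t / c * g c\<bar> \<le> g c * (1 / real (Suc n))" for n
  proof -
    define N where "N = real (Suc n)"
    define s where "s = c / N"
    define k where "k = nat \<lfloor>t / s\<rfloor>"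
    have N: "N > 0" and s: "s > 0" and Ns: "N * s = c"
      using \<open>c > 0\<close> by (auto simp: N_def s_def)
    have gs: "g c = N * g s"
      using mult[of s "Suc n"] s Ns by (simp add: N_def)
    have "real k \<le> t / s" "t / s < real k + 1"
      using \<open>0 \<le> t\<close> s unfolding k_def by (auto simp: of_nat_nat)
    then have k: "real k * s \<le> t" "t < real k * s + s"
      using s by (auto simp: field_simps)
    have sc: "s \<le> c"
      using Ns s mult_right_mono[of 1 N s] by (simp add: N_def)
    have pos: "0 \<le> g s" "0 \<le> g (t - real k * s)" "0 \<le> g (s - (t - real k * s))"
      using k s sc by (intro nonneg; linarith)+
    have "g s = g (t - real k * s) + g (s - (t - real k * s))"
      using add[of "t - real k * s" "s - (t - real k * s)"] k sc by simp
    then have 1: "g (t - real k * s) \<le> g s"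
      using pos(3) by simp
    have 2: "g t = real k * g s + g (t - real k * s)"
      using add[of "real k * s" "t - real k * s"] mult[of s k] k s \<open>t \<le> c\<close> by simp
    have 3: "t / c * g c = (t / s) * g s"
      using N s gs by (simp flip: Ns)
    \<comment> \<open>Both \<open>g t\<close> and its linear value lie between
      \<open>k * g s\<close> and \<open>(k + 1) * g s\<close>, so they differ by at most
      \<open>g s\<close>.\<close>
    have "real k * g s \<le> (t / s) * g s" "(t / s) * g s \<le> (real k + 1) * g s"
      using \<open>real k \<le> t / s\<close> \<open>t / s < real k + 1\<close> pos(1)
      by (intro mult_right_mono; simp)+
    then have "\<bar>g t - t / c * g c\<bar> \<le> g s"
      using 1 2 3 pos(2) by (simp add: algebra_simps)
    also have "g s = g c * (1 / N)"
      using gs N by simp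
    finally show ?thesis
      by (simp add: N_def)
  qed
  have "(\<lambda>n. g c * (1 / real (Suc n))) \<longlonglongrightarrow> g c * 0"
    by (intro tendsto_intros lim_1_over_n[THEN LIMSEQ_Suc])
  then have "\<bar>g t - t / c * g c\<bar> \<le> 0"
    using close by (intro LIMSEQ_le_const) auto
  then show ?thesis
    by simp
qed

section \<open>Rotations in a plane\<close>

text \<open>Parametrizing a unit circle by the angle turns rotations of its plane into shifts of the
  argument.\<close>

definition circle_vec :: "'a::real_vector \<Rightarrow> 'a \<Rightarrow> real \<Rightarrow> 'a" where
  "circle_vec e f t = cos t *\<^sub>R e + sin t *\<^sub>R f"

text \<open>The linear relation between three vectors of one plane. For \<open>s\<close>,
  \<open>t\<close> and \<open>s + t\<close> in the interval from 0 to \<pi> all coefficients are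
  nonnegative, so it controls signs of inner products when two adjacent wedges are joined.\<close>

lemma sin_scale_circle_vec:
  "sin (s + t) *\<^sub>R circle_vec e f b =
    sin t *\<^sub>R circle_vec e f (b - s) + sin s *\<^sub>R circle_vec e f (b + t)"
proof -
  have "sin (s + t) * cos b = sin t * cos (b - s) + sin s * cos (b + t)"
    and "sin (s + t) * sin b = sin t * sin (b - s) + sin s * sin (b + t)"
    by (simp_all add: sin_add cos_add sin_diff cos_diff algebra_simps)
  then show ?thesis
    by (simp add: circle_vec_def scaleR_add_right scaleR_add_left add_ac)
qed

text \<open>The witness is the identity plus a correction in the plane of \<open>e\<close> and
  \<open>f\<close>: it rotates that plane by \<open>a\<close> and fixes its orthogonal complement,
  without choosing a basis there.\<close>

lemma rotation_circle_vec:
  fixes e f :: "'a::euclidean_space"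
  assumes "norm e = 1" "norm f = 1" "e \<bullet> f = 0"
  obtains R where "orthogonal_transformation R" "\<And>t. R (circle_vec e f t) = circle_vec e f (t + a)"
proof
  let ?R = "\<lambda>x. x + ((cos a - 1) * (x \<bullet> e) - sin a * (x \<bullet> f)) *\<^sub>R e
                 + (sin a * (x \<bullet> e) + (cos a - 1) * (x \<bullet> f)) *\<^sub>R f"
  have ef: "e \<bullet> e = 1" "f \<bullet> f = 1" "e \<bullet> f = 0" "f \<bullet> e = 0"
    using assms by (auto simp: norm_eq_1 inner_commute)
  have "linear ?R"
    by (rule linearI) (simp_all add: inner_add_left algebra_simps)
  moreover have "?R v \<bullet> ?R w = v \<bullet> w" for v w
  proof -
    have expand: "(v + \<alpha> *\<^sub>R e + \<beta> *\<^sub>R f) \<bullet> (w + \<gamma> *\<^sub>R e + \<delta> *\<^sub>R f) =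
        v \<bullet> w + \<gamma> * (v \<bullet> e) + \<delta> * (v \<bullet> f) + \<alpha> * (w \<bullet> e) + \<beta> * (w \<bullet> f) + \<alpha> * \<gamma> + \<beta> * \<delta>"
      for \<alpha> \<beta> \<gamma> \<delta>
      by (simp add: inner_add_left inner_add_right ef inner_commute[of e w] inner_commute[of f w] algebra_simps)
    \<comment> \<open>Here \<open>C\<close> stands for \<open>cos a - 1\<close> and \<open>S\<close>
      for \<open>sin a\<close>, so the last factor vanishes by the Pythagorean identity.\<close>
    have ring: "k + (C * p' - S * q') * p + (S * p' + C * q') * q + (C * p - S * q) * p' +
          (S * p + C * q) * q' + (C * p - S * q) * (C * p' - S * q') +
          (S * p + C * q) * (S * p' + C * q') =
        k + (p * p' + q * q') * (S\<^sup>2 + (C + 1)\<^sup>2 - 1)" for k C S p q p' q' :: real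
      by (simp add: power2_eq_square algebra_simps)
    show ?thesis
      by (simp only: expand ring) simp
  qed
  ultimately show "orthogonal_transformation ?R"
    by (simp add: orthogonal_transformation_def)
  show "?R (circle_vec e f t) = circle_vec e f (t + a)" for t
    by (simp add: circle_vec_def inner_add_left ef cos_add sin_add algebra_simps)
qed


section \<open>Wedges of the unit ball and rotation invariance of volume\<close>

text \<open>For unit vectors this is the solid cone over the lune between the two hemispheres. One
  strict and one weak inequality make consecutive wedges disjoint.\<close>

definition ball_wedge :: "'a::real_inner \<Rightarrow> 'a \<Rightarrow> 'a set" where
  "ball_wedge y z = {x \<in> cball 0 1. 0 < x \<bullet> y \<and> x \<bullet> z \<le> 0}"

lemma ball_wedge_borel [measurable]: "ball_wedge y z \<in> sets (borel :: 'a::euclidean_space measure)"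
  unfolding ball_wedge_def by measurable

lemma ball_wedge_lmeasurable [simp]: "ball_wedge y z \<in> lmeasurable"
  for y :: "'a::euclidean_space"
proof (rule bounded_set_imp_lmeasurable)
  show "bounded (ball_wedge y z)"
    by (rule bounded_subset[of "cball 0 1"]) (auto simp: ball_wedge_def)
qed simp

lemma nn_integral_lborel_translation:
  fixes c :: "'a::euclidean_space"
  assumes "f \<in> borel_measurable borel"
  shows "(\<integral>\<^sup>+x. f (c + x) \<partial>lborel) = (\<integral>\<^sup>+x. f x \<partial>lborel)"
  using assms by (subst (2) lborel_distr_plus[of c, symmetric]) (simp add: nn_integral_distr)

text \<open>Uniqueness of translation-invariant measures by Fubini: both volumes times the volume of the
  unit ball \<open>B\<close> equal the double integral of \<open>1\<^sub>B (y - f x) 1\<^sub>A (f x)\<close>. The library's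
  \<open>measure_orthogonal_image\<close> requires a well-ordered index type.\<close>

lemma emeasure_lborel_orthogonal_vimage:
  fixes f :: "'a::euclidean_space \<Rightarrow> 'a"
  assumes f: "orthogonal_transformation f" and [measurable]: "A \<in> sets borel"
  shows "emeasure lborel (f -` A) = emeasure lborel A"
proof -
  interpret lborel_pair: pair_sigma_finite lborel "lborel :: 'a measure" ..
  have lin: "linear f"
    using f by (rule orthogonal_transformation_linear)
  then have [measurable]: "f \<in> borel_measurable borel"
    by (intro borel_measurable_continuous_onI linear_continuous_on linear_conv_bounded_linear[THEN iffD1])
  have [measurable]: "f -` A \<in> sets borel"
    using measurable_sets[of f borel borel A] by simp
  define \<beta> where "\<beta> x = (indicator (cball 0 1) x :: ennreal)" for x :: 'a
  define \<alpha> where "\<alpha> x = (indicator A x :: ennreal)" for x :: 'a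
  have [measurable]: "\<alpha> \<in> borel_measurable borel" "\<beta> \<in> borel_measurable borel"
    by (auto simp: \<alpha>_def[abs_def] \<beta>_def[abs_def] intro!: borel_measurable_indicator borel_closed)
  have \<beta>: "\<beta> (- f x) = \<beta> x" for x
    by (simp add: \<beta>_def indicator_def orthogonal_transformation_norm[OF f])
  have int_\<beta>: "(\<integral>\<^sup>+x. \<beta> x \<partial>lborel) = emeasure lborel (cball (0::'a) 1)"
    by (simp add: \<beta>_def)
  have int_\<alpha>: "(\<integral>\<^sup>+x. \<alpha> x \<partial>lborel) = emeasure lborel A"
    by (simp add: \<alpha>_def)
  have "\<alpha> (f x) = indicator (f -` A) x" for x
    by (simp add: \<alpha>_def indicator_def)
  then have "(\<integral>\<^sup>+x. \<beta> x \<partial>lborel) * emeasure lborel (f -` A) =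
      (\<integral>\<^sup>+x. (\<integral>\<^sup>+y. \<beta> y \<partial>lborel) * \<alpha> (f x) \<partial>lborel)"
    by (simp add: nn_integral_cmult)
  also have "\<dots> = (\<integral>\<^sup>+x. (\<integral>\<^sup>+y. \<beta> (y - f x) * \<alpha> (f x) \<partial>lborel) \<partial>lborel)"
    using nn_integral_lborel_translation[of \<beta> "- f _"] by (simp add: nn_integral_multc)
  also have "\<dots> = (\<integral>\<^sup>+y. (\<integral>\<^sup>+x. \<beta> (y - f x) * \<alpha> (f x) \<partial>lborel) \<partial>lborel)"
    by (rule lborel_pair.Fubini'[symmetric]) measurable
  also have "\<dots> = (\<integral>\<^sup>+y. (\<integral>\<^sup>+x. \<beta> x * \<alpha> (f x + y) \<partial>lborel) \<partial>lborel)"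
  proof (rule nn_integral_cong)
    fix y
    \<comment> \<open>Translating \<open>x\<close> by a preimage \<open>z\<close> of
      \<open>y\<close> turns \<open>y - f x\<close> into \<open>- f x\<close>, which has the norm of
      \<open>x\<close>; so the ball indicator no longer sees \<open>f\<close>.\<close>
    obtain z where "y = f z"
      using orthogonal_transformation_surj[OF f] by blast
    then have "(\<integral>\<^sup>+x. \<beta> (y - f x) * \<alpha> (f x) \<partial>lborel) =
        (\<integral>\<^sup>+x. \<beta> (y - f (z + x)) * \<alpha> (f (z + x)) \<partial>lborel)"
      by (subst nn_integral_lborel_translation[where f = "\<lambda>x. \<beta> (y - f x) * \<alpha> (f x)"]) auto
    also have "\<dots> = (\<integral>\<^sup>+x. \<beta> x * \<alpha> (f x + y) \<partial>lborel)"
      by (simp add: \<open>y = f z\<close> linear_add[OF lin] \<beta> add.commute)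
    finally show "(\<integral>\<^sup>+x. \<beta> (y - f x) * \<alpha> (f x) \<partial>lborel) = (\<integral>\<^sup>+x. \<beta> x * \<alpha> (f x + y) \<partial>lborel)" .
  qed
  also have "\<dots> = (\<integral>\<^sup>+x. (\<integral>\<^sup>+y. \<beta> x * \<alpha> (f x + y) \<partial>lborel) \<partial>lborel)"
    by (rule lborel_pair.Fubini') measurable
  also have "\<dots> = (\<integral>\<^sup>+x. \<beta> x \<partial>lborel) * (\<integral>\<^sup>+x. \<alpha> x \<partial>lborel)"
    by (simp add: nn_integral_cmult nn_integral_multc nn_integral_lborel_translation)
  finally have "emeasure lborel (cball (0::'a) 1) * emeasure lborel (f -` A) =
      emeasure lborel (cball (0::'a) 1) * emeasure lborel A"
    by (simp only: int_\<beta> int_\<alpha>)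
  \<comment> \<open>The ball has positive finite volume, so it can be cancelled in
    \<open>ennreal\<close>.\<close>
  moreover have "unit_ball_vol (real DIM('a)) > 0"
    by (rule unit_ball_vol_pos) simp
  ultimately show ?thesis
    by (subst (asm) ennreal_mult_cancel_left) (simp add: emeasure_cball)
qed

lemma measure_ball_wedge_circle_vec:
  fixes e f :: "'a::euclidean_space"
  assumes "norm e = 1" "norm f = 1" "e \<bullet> f = 0"
  shows "measure lebesgue (ball_wedge (circle_vec e f (s + a)) (circle_vec e f (t + a))) =
    measure lebesgue (ball_wedge (circle_vec e f s) (circle_vec e f t))"
proof -
  obtain R where R: "orthogonal_transformation R"
    and Ru: "\<And>t. R (circle_vec e f t) = circle_vec e f (t + a)"
    using rotation_circle_vec[OF assms] by blast
  have "R -` ball_wedge (R y) (R z) = ball_wedge y z" for y z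
    using R by (auto simp: ball_wedge_def orthogonal_transformation_def orthogonal_transformation_norm[OF R])
  then have "emeasure lborel (ball_wedge (R y) (R z)) = emeasure lborel (ball_wedge y z)" for y z
    using emeasure_lborel_orthogonal_vimage[OF R ball_wedge_borel, of "R y" "R z"] by simp
  from this[of "circle_vec e f s" "circle_vec e f t"] show ?thesis
    by (simp add: Ru measure_def)
qed

section \<open>The volume of a wedge as a function of its angle\<close>

lemma negligible_inner_eq_0:
  fixes y :: "'a::euclidean_space"
  assumes "y \<noteq> 0"
  shows "negligible {x. x \<bullet> y = 0}"
  using negligible_hyperplane[of y 0] assms by (simp add: inner_commute)

lemma norm_circle_vec:
  assumes "norm e = 1" "norm f = 1" "e \<bullet> f = 0"
  shows "norm (circle_vec e f t) = 1"
  using assms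
  by (simp add: norm_eq_1 circle_vec_def inner_add_left inner_add_right inner_commute[of f e]
      flip: power2_eq_square)

text \<open>The hyperplane orthogonal to the vector at angle \<open>s\<close> cuts the large wedge
  into the two small ones; \<open>sin_scale_circle_vec\<close> gives the sign of the third inner
  product from the other two.\<close>

lemma measure_ball_wedge_add:
  fixes e f :: "'a::euclidean_space"
  assumes ef: "norm e = 1" "norm f = 1" "e \<bullet> f = 0"
    and st: "0 \<le> s" "0 \<le> t" "s + t \<le> pi"
  shows "measure lebesgue (ball_wedge (circle_vec e f 0) (circle_vec e f (s + t))) =
    measure lebesgue (ball_wedge (circle_vec e f 0) (circle_vec e f s)) +
    measure lebesgue (ball_wedge (circle_vec e f s) (circle_vec e f (s + t)))"
proof -
  define u where "u = circle_vec e f"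
  have u0: "u r \<noteq> 0" for r
    using norm_circle_vec[OF ef, of r] by (auto simp: u_def)
  show ?thesis
    unfolding u_def[symmetric]
  proof (cases "s = 0 \<or> t = 0")
    case True
    have "ball_wedge (u r) (u r) = {}" for r
      by (auto simp: ball_wedge_def)
    with True show "measure lebesgue (ball_wedge (u 0) (u (s + t))) =
        measure lebesgue (ball_wedge (u 0) (u s)) + measure lebesgue (ball_wedge (u s) (u (s + t)))"
      by auto
  next
    case False
    \<comment> \<open>Both angles are positive with sum at most \<pi>, hence each is below \<pi>;
      only \<open>sin (s + t)\<close> can vanish.\<close>
    then have sin: "0 < sin s" "0 < sin t" "0 \<le> sin (s + t)"
      using st by (auto intro!: sin_gt_zero sin_ge_zero)
    have comb: "sin (s + t) * (x \<bullet> u s) = sin t * (x \<bullet> u 0) + sin s * (x \<bullet> u (s + t))" for x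
      using arg_cong[OF sin_scale_circle_vec[of s t e f s], of "inner x"]
      by (simp add: u_def inner_add_right)
    let ?A = "ball_wedge (u 0) (u s)" and ?B = "ball_wedge (u s) (u (s + t))"
    let ?C = "ball_wedge (u 0) (u (s + t))"
    have "x \<in> ?C" if "x \<in> ?A" for x
    proof -
      have x: "norm x \<le> 1" "0 < x \<bullet> u 0" "x \<bullet> u s \<le> 0"
        using that by (auto simp: ball_wedge_def)
      then have "sin s * (x \<bullet> u (s + t)) \<le> 0"
        using comb[of x] sin mult_nonneg_nonpos[of "sin (s + t)" "x \<bullet> u s"]
          mult_pos_pos[of "sin t" "x \<bullet> u 0"] by linarith
      then show ?thesis
        using x sin by (auto simp: ball_wedge_def mult_le_0_iff)
    qed
    \<comment> \<open>The null hyperplane is needed only when \<open>s + t = \<pi>\<close>.\<close>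
    moreover have "x \<in> ?C \<union> {x. x \<bullet> u 0 = 0}" if "x \<in> ?B" for x
    proof -
      have x: "norm x \<le> 1" "0 < x \<bullet> u s" "x \<bullet> u (s + t) \<le> 0"
        using that by (auto simp: ball_wedge_def)
      then have "0 \<le> sin t * (x \<bullet> u 0)"
        using comb[of x] sin mult_nonneg_nonpos[of "sin s" "x \<bullet> u (s + t)"]
          mult_nonneg_nonneg[of "sin (s + t)" "x \<bullet> u s"] by linarith
      then show ?thesis
        using x sin by (auto simp: ball_wedge_def zero_le_mult_iff)
    qed
    moreover have "?C \<subseteq> ?A \<union> ?B"
      by (auto simp: ball_wedge_def)
    ultimately have "sym_diff ?C (?A \<union> ?B) \<subseteq> {x. x \<bullet> u 0 = 0}"
      by auto
    then have "negligible (sym_diff ?C (?A \<union> ?B))"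
      using negligible_inner_eq_0[OF u0] negligible_subset by blast
    then have "measure lebesgue ?C = measure lebesgue (?A \<union> ?B)"
      by (intro measure_negligible_symdiff[symmetric]) auto
    also have "\<dots> = measure lebesgue ?A + measure lebesgue ?B"
    proof -
      have "?B - ?A = ?B"
        by (auto simp: ball_wedge_def)
      then show ?thesis
        by (simp add: measure_Un2)
    qed
    finally show "measure lebesgue ?C = measure lebesgue ?A + measure lebesgue ?B" .
  qed
qed


text \<open>Rotation invariance turns the splitting of wedges into additivity in the angle, hence
  linearity; the half ball at angle \<pi> fixes the constant.\<close>

lemma measure_ball_wedge_angle:
  fixes e f :: "'a::euclidean_space"
  assumes ef: "norm e = 1" "norm f = 1" "e \<bullet> f = 0" and t: "0 \<le> t" "t \<le> pi"
  shows "measure lebesgue (ball_wedge (circle_vec e f 0) (circle_vec e f t)) =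
    t / (2 * pi) * measure lebesgue (cball (0::'a) 1)"
proof -
  define g where "g t = measure lebesgue (ball_wedge (circle_vec e f 0) (circle_vec e f t))" for t
  have e0: "circle_vec e f 0 = e" and e1: "circle_vec e f pi = - e"
    and e2: "circle_vec e f (2 * pi) = e"
    by (simp_all add: circle_vec_def)
  have g_t: "g t = t / pi * g pi"
  proof (rule additive_nonneg_imp_linear_on_interval)
    fix s t :: real
    assume "0 \<le> s" "0 \<le> t" "s + t \<le> pi"
    then show "g (s + t) = g s + g t"
      using measure_ball_wedge_add[OF ef, of s t] measure_ball_wedge_circle_vec[OF ef, of 0 s t]
      by (simp add: g_def add.commute)
  qed (use t in \<open>auto simp: g_def\<close>)
  \<comment> \<open>The wedges from 0 to \<pi> and from \<pi> to 2\<pi> are congruent half balls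
    that cover the ball up to a hyperplane.\<close>
  have g_pi: "2 * g pi = measure lebesgue (cball (0::'a) 1)"
  proof -
    let ?A = "ball_wedge e (- e)" and ?B = "ball_wedge (- e) e"
    have "?B - ?A = ?B"
      by (auto simp: ball_wedge_def)
    then have "measure lebesgue (?A \<union> ?B) = measure lebesgue ?A + measure lebesgue ?B"
      by (simp add: measure_Un2)
    also have "\<dots> = 2 * g pi"
      using measure_ball_wedge_circle_vec[OF ef, of 0 pi pi] by (simp add: g_def e0 e1 e2)
    finally have "2 * g pi = measure lebesgue (?A \<union> ?B)" ..
    also have "\<dots> = measure lebesgue (cball (0::'a) 1)"
    proof (rule measure_negligible_symdiff)
      have "sym_diff (cball 0 1) (?A \<union> ?B) \<subseteq> {x. x \<bullet> e = 0}"
        by (auto simp: ball_wedge_def)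
      moreover have "e \<noteq> 0"
        using ef(1) by auto
      ultimately show "negligible (sym_diff (cball 0 1) (?A \<union> ?B))"
        by (intro negligible_subset[OF negligible_inner_eq_0])
    qed simp
    finally show ?thesis .
  qed
  show ?thesis
    unfolding g_def[symmetric] g_pi[symmetric] g_t by simp
qed

section \<open>Intersections of two half spaces with the ball\<close>

text \<open>Gram-Schmidt: \<open>f\<close> is the normalized component of \<open>z\<close>
  orthogonal to \<open>y\<close>, and the length of that component is the sine of the angle.\<close>

lemma unit_vec_eq_circle_vec:
  fixes y z :: "'a::euclidean_space"
  assumes yz: "norm y = 1" "norm z = 1" and "2 \<le> DIM('a)"
  obtains f where "norm f = 1" "y \<bullet> f = 0" "z = circle_vec y f (arccos (y \<bullet> z))"
proof -
  define c where "c = y \<bullet> z"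
  define w where "w = z - c *\<^sub>R y"
  have c: "-1 \<le> c" "c \<le> 1"
    using Cauchy_Schwarz_ineq2[of y z] yz by (auto simp: c_def)
  have yw: "y \<bullet> w = 0"
    using yz by (simp add: w_def inner_diff_right c_def norm_eq_1)
  have "w \<bullet> w = 1 - c\<^sup>2"
    using yz by (simp add: w_def inner_diff_left inner_diff_right norm_eq_1 power2_eq_square
        inner_commute[of z y] flip: c_def)
  then have norm_w: "norm w = sin (arccos c)"
    using c by (simp add: sin_arccos norm_eq_sqrt_inner)
  show thesis
  proof (cases "w = 0")
    case True
    \<comment> \<open>Now \<open>z\<close> is \<open>y\<close> or \<open>- y\<close> and the sine
      vanishes, so any unit vector orthogonal to \<open>y\<close> serves; dimension at least 2
      provides one.\<close>
    obtain v where v: "v \<noteq> 0" "y \<bullet> v = 0"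
      using orthogonal_to_vector_exists[of y] assms(3) by (auto simp: orthogonal_def)
    show thesis
    proof
      show "norm (v /\<^sub>R norm v) = 1" "y \<bullet> (v /\<^sub>R norm v) = 0"
        using v by auto
      show "z = circle_vec y (v /\<^sub>R norm v) (arccos (y \<bullet> z))"
        using True norm_w c unfolding c_def[symmetric] by (simp add: circle_vec_def w_def)
    qed
  next
    case False
    show thesis
    proof
      show "norm (w /\<^sub>R norm w) = 1" "y \<bullet> (w /\<^sub>R norm w) = 0"
        using False yw by auto
      show "z = circle_vec y (w /\<^sub>R norm w) (arccos (y \<bullet> z))"
        using False c unfolding c_def[symmetric] circle_vec_def norm_w[symmetric]
        by (simp add: w_def)
    qed
  qed
qed

text \<open>\<open>ball_wedge y (- y)\<close> is a half ball; removing the wedge of angle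
  \<open>\<theta>\<close> leaves the fraction \<open>(pi - \<theta>) / (2 * pi)\<close> of the
  ball.\<close>

lemma measure_ball_two_halfspaces:
  fixes y z :: "'a::euclidean_space"
  assumes "norm y = 1" "norm z = 1" "2 \<le> DIM('a)"
  shows "measure lebesgue {x \<in> cball 0 1. 0 < x \<bullet> y \<and> 0 < x \<bullet> z} =
    (1 - normalized_geodesic_dist y z) / 2 * measure lebesgue (cball (0::'a) 1)"
proof -
  define \<theta> where "\<theta> = arccos (y \<bullet> z)"
  obtain f where f: "norm f = 1" "y \<bullet> f = 0" and z: "z = circle_vec y f \<theta>"
    using unit_vec_eq_circle_vec[OF assms] unfolding \<theta>_def by blast
  have \<theta>: "0 \<le> \<theta>" "\<theta> \<le> pi"
    using Cauchy_Schwarz_ineq2[of y z] assms by (auto simp: \<theta>_def intro: arccos_lbound arccos_ubound)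
  let ?C = "{x \<in> cball 0 1. 0 < x \<bullet> y \<and> 0 < x \<bullet> z}"
  have y0: "circle_vec y f 0 = y" and y1: "circle_vec y f pi = - y"
    by (simp_all add: circle_vec_def)
  have "?C = ball_wedge y (- y) - ball_wedge y z"
    by (auto simp: ball_wedge_def)
  moreover have "ball_wedge y z \<subseteq> ball_wedge y (- y)"
    by (auto simp: ball_wedge_def)
  ultimately have "measure lebesgue ?C =
      measure lebesgue (ball_wedge y (- y)) - measure lebesgue (ball_wedge y z)"
    by (simp add: measurable_measure_Diff fmeasurableD)
  also have "\<dots> = pi / (2 * pi) * measure lebesgue (cball (0::'a) 1) -
      \<theta> / (2 * pi) * measure lebesgue (cball (0::'a) 1)"
    using measure_ball_wedge_angle[OF assms(1) f \<theta>] measure_ball_wedge_angle[OF assms(1) f, of pi]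
    by (simp add: y0 y1 flip: z)
  also have "\<dots> = (1 - normalized_geodesic_dist y z) / 2 * measure lebesgue (cball (0::'a) 1)"
    by (simp add: normalized_geodesic_dist_def field_simps flip: \<theta>_def)
  finally show ?thesis .
qed

section \<open>From volumes of cones to surface measure\<close>

text \<open>The dimension factor of the surface measure cancels against the same factor in its total
  mass.\<close>

lemma measure_normalized_surface_measure:
  fixes A :: "'a::euclidean_space set"
  assumes "A \<in> sets (restrict_space borel (sphere 0 1))"
  shows "measure normalized_surface_measure A =
    measure lebesgue (radial_cone A) / measure lebesgue (cball (0::'a) 1)"
proof -
  define V where "V = measure lebesgue (cball (0::'a) 1)"
  have V: "V = unit_ball_vol DIM('a)" "V > 0"
    using content_cball[of 1 "0::'a"] content_cball_pos[of 1 "0::'a"] by (auto simp: V_def)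
  have cone: "radial_cone A \<in> lmeasurable"
  proof (rule bounded_set_imp_lmeasurable)
    show "bounded (radial_cone A)"
    proof (rule bounded_subset)
      have "A \<subseteq> sphere 0 1"
        using sets.sets_into_space[OF assms] by (simp add: space_restrict_space)
      then show "radial_cone A \<subseteq> cball 0 1"
        by (auto simp: radial_cone_eq_vimage)
    qed simp
    show "radial_cone A \<in> sets lebesgue"
      using borel_radial_cone[OF assms] by simp
  qed
  \<comment> \<open>Surface measure is defined through \<open>lborel\<close>, wedge volumes are
    taken in \<open>lebesgue\<close>; the two agree on this Borel cone.\<close>
  then have "emeasure lborel (radial_cone A) = ennreal (measure lebesgue (radial_cone A))"
    using emeasure_eq_measure2[OF cone] borel_radial_cone[OF assms] by simp
  then have "emeasure normalized_surface_measure A =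
      1 / ennreal (DIM('a) * V) * (of_nat DIM('a) * ennreal (measure lebesgue (radial_cone A)))"
    by (simp add: normalized_surface_measure_def emeasure_sphere_surface_measure[OF assms]
        emeasure_sphere_surface_measure_sphere V)
  also have "\<dots> = ennreal (1 / (DIM('a) * V) * (DIM('a) * measure lebesgue (radial_cone A)))"
    using V(2) by (simp add: ennreal_of_nat_eq_real_of_nat divide_ennreal flip: ennreal_mult ennreal_1)
  also have "1 / (DIM('a) * V) * (DIM('a) * measure lebesgue (radial_cone A)) =
      measure lebesgue (radial_cone A) / V"
    by simp
  finally show ?thesis
    using V(2) by (simp add: measure_def V_def)
qed

lemma measure_normalized_surface_measure_two_halfspaces:
  fixes y z :: "'a::euclidean_space"
  assumes "norm y = 1" "norm z = 1" "2 \<le> DIM('a)"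
  shows "measure normalized_surface_measure {x \<in> sphere 0 1. 0 < x \<bullet> y \<and> 0 < x \<bullet> z} =
    (1 - normalized_geodesic_dist y z) / 2"
proof -
  let ?A = "{x \<in> sphere 0 1. 0 < x \<bullet> y \<and> 0 < x \<bullet> z}"
  have A: "?A \<in> sets (restrict_space borel (sphere 0 1))"
    by (auto simp: sets_restrict_space_iff)
  \<comment> \<open>Strict half-space conditions are invariant under positive scaling and exclude
    the origin.\<close>
  have "radial_cone ?A = {x \<in> cball 0 1. 0 < x \<bullet> y \<and> 0 < x \<bullet> z}"
    by (subst radial_cone_eq_vimage) (auto simp: zero_less_mult_iff intro!: left_inverse)
  then show ?thesis
    using content_cball_pos[of 1 "0::'a"]
    by (simp only: measure_normalized_surface_measure[OF A] measure_ball_two_halfspaces[OF assms]) simp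
qed

section \<open>Expanding the square and applying Fubini\<close>

lemma hemisphere_discrepancy_identity:
  fixes \<mu> :: "'a::euclidean_space measure"
  assumes dim: "2 \<le> DIM('a)"
    and sets_\<mu>: "sets \<mu> = sets (restrict_space borel (sphere 0 1))"
    and "emeasure \<mu> (sphere 0 1) = 1"
  shows "(\<integral>x. (measure \<mu> (open_hemisphere x) - 1 / 2)\<^sup>2 \<partial>normalized_surface_measure) =
    1 / 2 * (1 / 2 - geodesic_energy \<mu>)"
proof -
  define \<sigma> where "\<sigma> = (normalized_surface_measure :: 'a measure)"
  have space_\<mu>: "space \<mu> = sphere 0 1"
    using sets_eq_imp_space_eq[OF sets_\<mu>] by (simp add: space_restrict_space)
  have sets_\<sigma>: "sets \<sigma> = sets (restrict_space borel (sphere 0 1))" and space_\<sigma>: "space \<sigma> = sphere 0 1"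
    by (simp_all add: \<sigma>_def)
  interpret \<mu>: prob_space \<mu>
    by (rule prob_spaceI) (simp add: space_\<mu> assms)
  interpret \<sigma>: prob_space \<sigma>
    by (rule prob_spaceI) (simp add: space_\<sigma>, simp add: \<sigma>_def emeasure_normalized_surface_measure_sphere)
  interpret \<mu>\<mu>: pair_prob_space \<mu> \<mu> ..
  interpret \<sigma>\<mu>: pair_prob_space \<sigma> \<mu> ..
  interpret \<sigma>\<mu>\<mu>: pair_prob_space \<sigma> "\<mu> \<Otimes>\<^sub>M \<mu>" ..
  \<comment> \<open>Both \<sigma>-algebras live on the sphere; measurability of the inclusion into
    the ambient space makes inner products measurable.\<close>
  have id_\<mu> [measurable]: "(\<lambda>x. x) \<in> borel_measurable \<mu>"
    by (subst measurable_cong_sets[OF sets_\<mu> refl]) (simp add: measurable_restrict_space1)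
  have id_\<sigma> [measurable]: "(\<lambda>x. x) \<in> borel_measurable \<sigma>"
    by (subst measurable_cong_sets[OF sets_\<sigma> refl]) (simp add: measurable_restrict_space1)
  \<comment> \<open>This kernel is symmetric: integrating out \<open>y\<close> measures the
    hemisphere at \<open>x\<close>, integrating out \<open>x\<close> the one at
    \<open>y\<close>.\<close>
  define h where "h x y = (if 0 < x \<bullet> y then 1 else 0 :: real)" for x y :: 'a
  define m where "m x = measure \<mu> (open_hemisphere x)" for x :: 'a
  have h_bound: "\<bar>h x y\<bar> \<le> 1" for x y
    by (simp add: h_def)
  have [measurable]: "(\<lambda>(x, y). h x y) \<in> borel_measurable (\<sigma> \<Otimes>\<^sub>M \<mu>)"
    using measurable_compose[OF measurable_fst id_\<sigma>] measurable_compose[OF measurable_snd id_\<mu>]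
    unfolding h_def by measurable
  have int_h: "integrable (\<sigma> \<Otimes>\<^sub>M \<mu>) (\<lambda>(x, y). h x y)"
    by (rule \<sigma>\<mu>.integrable_const_bound[where B = 1]) (auto simp: h_bound)
  have [measurable]: "(\<lambda>(x, p). h x (fst p) * h x (snd p)) \<in> borel_measurable (\<sigma> \<Otimes>\<^sub>M (\<mu> \<Otimes>\<^sub>M \<mu>))"
    using measurable_compose[OF measurable_fst id_\<sigma>]
      measurable_compose[OF measurable_compose[OF measurable_snd measurable_fst] id_\<mu>]
      measurable_compose[OF measurable_compose[OF measurable_snd measurable_snd] id_\<mu>]
    unfolding h_def by measurable
  have int_hh: "integrable (\<sigma> \<Otimes>\<^sub>M (\<mu> \<Otimes>\<^sub>M \<mu>)) (\<lambda>(x, p). h x (fst p) * h x (snd p))"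
    by (rule \<sigma>\<mu>\<mu>.integrable_const_bound[where B = 1]) (auto simp: h_def)
  have [measurable]: "h x \<in> borel_measurable \<mu>" for x
    unfolding h_def[abs_def] by measurable
  have m: "m x = (\<integral>y. h x y \<partial>\<mu>)" for x
  proof -
    have "(\<integral>y. h x y \<partial>\<mu>) = (\<integral>y. indicator (open_hemisphere x) y \<partial>\<mu>)"
      by (intro Bochner_Integration.integral_cong refl)
        (auto simp: h_def open_hemisphere_def space_\<mu> inner_commute indicator_def)
    also have "\<dots> = measure \<mu> (open_hemisphere x \<inter> space \<mu>)"
      by simp
    also have "open_hemisphere x \<inter> space \<mu> = open_hemisphere x"
      by (auto simp: open_hemisphere_def space_\<mu>)
    finally show ?thesis
      by (simp add: m_def)
  qed
  have mm: "(m x)\<^sup>2 = (\<integral>p. h x (fst p) * h x (snd p) \<partial>(\<mu> \<Otimes>\<^sub>M \<mu>))" for x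
  proof -
    have "integrable (\<mu> \<Otimes>\<^sub>M \<mu>) (\<lambda>(y, z). h x y * h x z)"
      by (rule \<mu>\<mu>.integrable_const_bound[where B = 1]) (auto simp: h_def)
    from \<mu>\<mu>.integral_fst[OF this] show ?thesis
      by (simp add: m power2_eq_square case_prod_unfold)
  qed
  have overlap: "(\<integral>x. h x y * h x z \<partial>\<sigma>) = (1 - normalized_geodesic_dist y z) / 2"
    if "y \<in> sphere 0 1" "z \<in> sphere 0 1" for y z
  proof -
    let ?A = "{x \<in> sphere 0 1. 0 < x \<bullet> y \<and> 0 < x \<bullet> z}"
    have "(\<integral>x. h x y * h x z \<partial>\<sigma>) = (\<integral>x. indicator ?A x \<partial>\<sigma>)"
      by (intro Bochner_Integration.integral_cong refl) (auto simp: h_def space_\<sigma> indicator_def)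
    also have "\<dots> = measure \<sigma> (?A \<inter> space \<sigma>)"
      by simp
    also have "?A \<inter> space \<sigma> = ?A"
      by (auto simp: space_\<sigma>)
    finally show ?thesis
      using measure_normalized_surface_measure_two_halfspaces[of y z] that dim
      by (simp only: \<sigma>_def) simp
  qed
  have mean: "(\<integral>x. h x y \<partial>\<sigma>) = 1 / 2" if "y \<in> sphere 0 1" for y
  proof -
    \<comment> \<open>The kernel takes only the values 0 and 1, so its mean is the overlap of a
      hemisphere with itself, at distance 0.\<close>
    have "h x y * h x y = h x y" for x
      by (simp add: h_def)
    then have "(\<integral>x. h x y \<partial>\<sigma>) = (1 - normalized_geodesic_dist y y) / 2"
      using overlap[OF that that] by (simp only:)
    then show ?thesis
      using that by (simp add: normalized_geodesic_dist_def norm_eq_1)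
  qed
  have int_m: "integrable \<sigma> m"
    using \<sigma>\<mu>.integrable_fst[OF int_h]
    by (simp add: m[abs_def] case_prod_unfold)
  have int_mm: "integrable \<sigma> (\<lambda>x. (m x)\<^sup>2)"
    using \<sigma>\<mu>\<mu>.integrable_fst[OF int_hh]
    by (simp only: mm case_prod_unfold fst_conv snd_conv)
  have "(\<integral>x. m x \<partial>\<sigma>) = (\<integral>x. (\<integral>y. h x y \<partial>\<mu>) \<partial>\<sigma>)"
    by (simp only: m)
  also have "\<dots> = (\<integral>y. (\<integral>x. h x y \<partial>\<sigma>) \<partial>\<mu>)"
    by (rule \<sigma>\<mu>.Fubini_integral[OF int_h, symmetric])
  also have "\<dots> = (\<integral>y. 1 / 2 \<partial>\<mu>)"
    by (intro Bochner_Integration.integral_cong refl mean) (simp add: space_\<mu>)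
  finally have m_integral: "(\<integral>x. m x \<partial>\<sigma>) = 1 / 2"
    by (simp add: \<mu>.prob_space)
  define D where "D p = normalized_geodesic_dist (fst p) (snd p)" for p :: "'a \<times> 'a"
  have D: "D p = 1 - 2 * (\<integral>x. h x (fst p) * h x (snd p) \<partial>\<sigma>)" if "p \<in> space (\<mu> \<Otimes>\<^sub>M \<mu>)" for p
    using that by (auto simp: D_def overlap space_pair_measure space_\<mu> field_simps)
  \<comment> \<open>Integrability of the distance comes from Fubini, since \<open>D\<close> is an
    affine function of the overlap integral.\<close>
  have int_D: "integrable (\<mu> \<Otimes>\<^sub>M \<mu>) D"
    using \<sigma>\<mu>\<mu>.integrable_snd[OF int_hh]
    by (subst Bochner_Integration.integrable_cong[OF refl D]) auto
  have "(\<integral>x. (m x)\<^sup>2 \<partial>\<sigma>) = (\<integral>x. (\<integral>p. h x (fst p) * h x (snd p) \<partial>(\<mu> \<Otimes>\<^sub>M \<mu>)) \<partial>\<sigma>)"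
    by (simp only: mm)
  also have "\<dots> = (\<integral>p. (\<integral>x. h x (fst p) * h x (snd p) \<partial>\<sigma>) \<partial>(\<mu> \<Otimes>\<^sub>M \<mu>))"
    by (rule \<sigma>\<mu>\<mu>.Fubini_integral[OF int_hh, symmetric])
  also have "\<dots> = (\<integral>p. 1 / 2 - D p / 2 \<partial>(\<mu> \<Otimes>\<^sub>M \<mu>))"
    by (intro Bochner_Integration.integral_cong refl) (simp add: D field_simps)
  also have "\<dots> = 1 / 2 - (\<integral>p. D p \<partial>(\<mu> \<Otimes>\<^sub>M \<mu>)) / 2"
    using int_D by (simp add: \<mu>\<mu>.prob_space)
  \<comment> \<open>The energy integrates the first argument innermost, which is the order of
    \<open>integral_snd\<close>.\<close>
  also have "(\<integral>p. D p \<partial>(\<mu> \<Otimes>\<^sub>M \<mu>)) = geodesic_energy \<mu>"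
    using \<mu>\<mu>.integral_snd[of normalized_geodesic_dist] int_D
    by (simp add: D_def[abs_def] geodesic_energy_def case_prod_unfold)
  finally have mm_integral: "(\<integral>x. (m x)\<^sup>2 \<partial>\<sigma>) = 1 / 2 - geodesic_energy \<mu> / 2" .
  have "(\<integral>x. (m x - 1 / 2)\<^sup>2 \<partial>\<sigma>) = (\<integral>x. (m x)\<^sup>2 - m x + 1 / 4 \<partial>\<sigma>)"
    by (intro Bochner_Integration.integral_cong refl) (simp add: power2_eq_square algebra_simps)
  also have "\<dots> = (\<integral>x. (m x)\<^sup>2 \<partial>\<sigma>) - (\<integral>x. m x \<partial>\<sigma>) + 1 / 4"
    using int_m int_mm by (simp add: \<sigma>.prob_space)
  also have "\<dots> = 1 / 2 * (1 / 2 - geodesic_energy \<mu>)"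
    by (simp add: m_integral mm_integral)
  finally show ?thesis
    by (simp add: m_def \<sigma>_def)
qed

text \<open>The space \<open>real ^ 'n\<close> has dimension \<open>d + 1\<close>, which is at least
  2, so the general identity applies to its unit sphere.\<close>

theorem theorem4p1:
  fixes d :: nat and \<mu> :: "(real ^ 'n) measure"
  assumes "d \<ge> 1" and "CARD('n) = d + 1"
    and "sets \<mu> = sets (restrict_space borel (sphere 0 1))"
    and "emeasure \<mu> (sphere 0 1) = 1"
  shows "(\<integral>x. (measure \<mu> (open_hemisphere x) - 1 / 2)\<^sup>2 \<partial>normalized_surface_measure) =
    1 / 2 * (1 / 2 - geodesic_energy \<mu>)"
  using assms by (intro hemisphere_discrepancy_identity) auto

end
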